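(* Let $f:\subseteq X\rightrightarrows Y$ be a problem and consider the Wadge game of $f$. Then: (1) $f$ is continuous if and only if Player II has a winning strategy for $f$; (2) $f$ is effectively discontinuous if and only if Player I has a winning strategy for $f$.
   Context: Work in ZF + dependent choice. A represented space is $(X,\delta_X)$ with $\delta_X:\subseteq\mathbb{N}^\mathbb{N}\to X$ a partial surjection. A problem $f:\subseteq X\rightrightarrows Y$ is a partial multivalued function that has a realizer $F:\subseteq\mathbb{N}^\mathbb{N}\to\mathbb{N}^\mathbb{N}$ ($\delta_YF(p)\in f\delta_X(p)$ for all $p\in\mathrm{dom}(f\delta_X)$); it is continuous if it has a continuous realizer. Its realizer version is $f^{\mathrm r}:=\delta_Y^{-1}\circ f\circ\delta_X:\subseteq\mathbb{N}^\mathbb{N}\rightrightarrows\mathbb{N}^\mathbb{N}$. $\Phi$ is the standard total representation of continuous partial functions on Baire space ($\Phi_q(p)=\sup_{w\sqsubseteq p}h(w)$ for the monotone word function $h$ whose graph is listed by $q$; every continuous partial function has an extension $\Phi_q$). $f$ is effectively discontinuous if there is a continuous total $D:\mathbb{N}^\mathbb{N}\to\mathbb{N}^\mathbb{N}$ with $D(q)\in\mathrm{dom}(f\delta_X)$ and $\delta_Y\Phi_qD(q)\notin f\delta_XD(q)$ for all $q$ (counted as satisfied when the left side is undefined). Wadge game of $g:\subseteq\mathbb{N}^\mathbb{N}\rightrightarrows\mathbb{N}^\mathbb{N}$: Players I and II alternately play finite words $x_0,y_0,x_1,y_1,\dots\in\mathbb{N}^*$ (I starts, empty words allowed); let $x=x_0x_1\dots$,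 $y=y_0y_1\dots\in\mathbb{N}^\mathbb{N}\cup\mathbb{N}^*$. Player II wins the run if $(x,y)\in\mathrm{graph}(g)$ or $x\notin\mathrm{dom}(g)$; otherwise Player I wins. The Wadge game of a general problem $f$ is the Wadge game of $f^{\mathrm r}$. A winning strategy for II is a function $\sigma:(\mathbb{N}^* )^*\to\mathbb{N}^*$ such that II wins every run in which $y_i=\sigma(x_0,\dots,x_i)$; a winning strategy for I is $\sigma$ such that I wins every run in which $x_i=\sigma(y_0,\dots,y_{i-1})$. *)

theory Defs
  imports "HOL-Analysis.Analysis" "HOL-Library.Sublist" "HOL-Library.Nat_Bijection"
begin

text \<open>
  Baire space is the type \<^typ>\<open>nat \<Rightarrow> nat\<close> with the library's product topology (\<^typ>\<open>nat\<close> is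
  discrete). Partial functions are maps into \<^type>\<open>option\<close>; a multivalued function is given by its
  graph, so that its domain is \<^const>\<open>Domain\<close>.
\<close>

type_synonym baire = "nat \<Rightarrow> nat"
type_synonym word = "nat list"

section \<open>Finite and infinite words\<close>

datatype inf_word = FinW word | InfW baire

definition seq_take :: "nat \<Rightarrow> baire \<Rightarrow> word" where
  "seq_take n p = map p [0..<n]"

definition seq_prefix :: "word \<Rightarrow> baire \<Rightarrow> bool" where
  "seq_prefix w p \<longleftrightarrow> w = seq_take (length w) p"

fun inf_word_prefix :: "inf_word \<Rightarrow> inf_word \<Rightarrow> bool" where
  "inf_word_prefix (FinW u) (FinW v) = prefix u v"
| "inf_word_prefix (FinW u) (InfW p) = seq_prefix u p"
| "inf_word_prefix (InfW p) (FinW v) = False"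
| "inf_word_prefix (InfW p) (InfW r) = (p = r)"

definition word_chain :: "word set \<Rightarrow> bool" where
  "word_chain W \<longleftrightarrow> (\<forall>u\<in>W. \<forall>v\<in>W. prefix u v \<or> prefix v u)"

text \<open>
  The supremum of a set of words that is a chain for the prefix order; the lemma
  \<open>word_sup_is_lub\<close> below justifies the formula. It is only ever applied to chains.
\<close>

definition word_sup :: "word set \<Rightarrow> inf_word" where
  "word_sup W =
     (if finite W then FinW (ARG_MAX length w. w \<in> insert [] W)
      else InfW (\<lambda>k. THE a. \<exists>w\<in>W. k < length w \<and> w ! k = a))"

lemma length_seq_take [simp]: "length (seq_take n p) = n"
  by (simp add: seq_take_def)

lemma nth_seq_take [simp]: "k < n \<Longrightarrow> seq_take n p ! k = p k"
  by (simp add: seq_take_def)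

lemma seq_prefix_iff: "seq_prefix w p \<longleftrightarrow> (\<forall>k<length w. w ! k = p k)"
  by (auto simp: seq_prefix_def list_eq_iff_nth_eq)

lemma seq_prefix_seq_take [simp]: "seq_prefix (seq_take n p) p"
  by (simp add: seq_prefix_def)

lemma prefix_iff_nth: "prefix u v \<longleftrightarrow> length u \<le> length v \<and> (\<forall>k<length u. u ! k = v ! k)"
proof
  assume "prefix u v"
  then show "length u \<le> length v \<and> (\<forall>k<length u. u ! k = v ! k)"
    by (auto simp: prefix_def nth_append)
next
  assume a: "length u \<le> length v \<and> (\<forall>k<length u. u ! k = v ! k)"
  then have "u = take (length u) v"
    by (auto simp: list_eq_iff_nth_eq)
  then show "prefix u v"
    by (metis take_is_prefix)
qed

lemma seq_prefix_comparable:
  assumes "seq_prefix u p" "seq_prefix v p"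
  shows "prefix u v \<or> prefix v u"
  using assms nat_le_linear[of "length u" "length v"] by (auto simp: seq_prefix_iff prefix_iff_nth)

lemma word_sup_finite:
  assumes "word_chain W" "finite W"
  obtains m where "word_sup W = FinW m" "m \<in> insert [] W" "\<And>w. w \<in> W \<Longrightarrow> prefix w m"
proof -
  define m where "m = (ARG_MAX length w. w \<in> insert [] W)"
  have fin: "finite (length ` insert [] W)" using assms by simp
  have bd: "length y \<le> Max (length ` insert [] W)" if "y \<in> insert [] W" for y
    using fin that by (intro Max_ge) auto
  have "m \<in> insert [] W \<and> (\<forall>y. y \<in> insert [] W \<longrightarrow> length y \<le> length m)"
    unfolding m_def
    by (rule arg_max_nat_lemma[where k = "[]" and b = "Suc (Max (length ` insert [] W))"])
       (use bd in \<open>auto simp: less_Suc_eq_le\<close>)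
  then have m: "m \<in> insert [] W" "\<And>y. y \<in> W \<Longrightarrow> length y \<le> length m" by auto
  have "prefix w m" if "w \<in> W" for w
  proof (cases "m \<in> W")
    case True
    then have "prefix w m \<or> prefix m w" using assms(1) that unfolding word_chain_def by blast
    then show ?thesis using m(2)[OF that] by (auto simp: prefix_def)
  next
    case False
    then show ?thesis using m(1) m(2)[OF that] by simp
  qed
  with m(1) show thesis using that assms(2) by (simp add: word_sup_def m_def)
qed

lemma word_chain_nth:
  assumes "word_chain W" "u \<in> W" "v \<in> W" "k < length u" "k < length v"
  shows "u ! k = v ! k"
proof -
  have "prefix u v \<or> prefix v u" using assms unfolding word_chain_def by blast
  then show ?thesis using assms(4,5) by (auto simp: prefix_iff_nth)
qed

lemma word_chain_infinite_long:
  assumes "word_chain W" "infinite W"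
  shows "\<exists>w\<in>W. n < length w"
proof (rule ccontr)
  assume "\<not> ?thesis"
  then have le: "\<And>w. w \<in> W \<Longrightarrow> length w \<le> n" by force
  have "inj_on length W"
  proof (rule inj_onI)
    fix u v assume uv: "u \<in> W" "v \<in> W" "length u = length v"
    then have "prefix u v \<or> prefix v u" using assms(1) unfolding word_chain_def by blast
    then show "u = v" using uv(3) by (auto simp: prefix_def)
  qed
  moreover have "finite (length ` W)"
    by (rule finite_subset[of _ "{..n}"]) (use le in auto)
  ultimately show False using assms(2) finite_imageD[of length W] by simp
qed

lemma word_sup_infinite:
  assumes "word_chain W" "infinite W"
  obtains p where "word_sup W = InfW p" "\<And>w. w \<in> W \<Longrightarrow> seq_prefix w p"
proof -
  define p where "p = (\<lambda>k. THE a. \<exists>w\<in>W. k < length w \<and> w ! k = a)"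
  have "p k = w ! k" if "w \<in> W" "k < length w" for w k
    unfolding p_def
    by (rule the_equality) (use that word_chain_nth[OF assms(1)] in blast)+
  then have "\<And>w. w \<in> W \<Longrightarrow> seq_prefix w p"
    by (simp add: seq_prefix_iff)
  then show thesis using that assms(2) by (simp add: word_sup_def p_def)
qed

lemma word_sup_is_lub:
  assumes "word_chain W"
  shows "\<forall>w\<in>W. inf_word_prefix (FinW w) (word_sup W)"
    and "(\<forall>w\<in>W. inf_word_prefix (FinW w) z) \<Longrightarrow> inf_word_prefix (word_sup W) z"
proof -
  show "\<forall>w\<in>W. inf_word_prefix (FinW w) (word_sup W)"
    using word_sup_finite[OF assms] word_sup_infinite[OF assms]
    by (metis inf_word_prefix.simps(1,2))
next
  assume z: "\<forall>w\<in>W. inf_word_prefix (FinW w) z"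
  show "inf_word_prefix (word_sup W) z"
  proof (cases "finite W")
    case True
    then obtain m where m: "word_sup W = FinW m" "m \<in> insert [] W"
      using word_sup_finite[OF assms] by metis
    show ?thesis
    proof (cases "m = []")
      case True
      then show ?thesis using m(1) by (cases z) (auto simp: seq_prefix_iff)
    next
      case False
      then show ?thesis using m z by auto
    qed
  next
    case False
    then obtain p where p: "word_sup W = InfW p" "\<And>w. w \<in> W \<Longrightarrow> seq_prefix w p"
      using word_sup_infinite[OF assms] by metis
    show ?thesis
    proof (cases z)
      case (FinW v)
      obtain w where w: "w \<in> W" "length v < length w"
        using word_chain_infinite_long[OF assms False] by blast
      then have "prefix w v" using z FinW by auto
      with w(2) show ?thesis by (auto dest: prefix_length_le)
    next
      case (InfW r)
      have "p k = r k" for k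
      proof -
        obtain w where "w \<in> W" "k < length w"
          using word_chain_infinite_long[OF assms False] by blast
        then show ?thesis using z InfW p(2) by (metis inf_word_prefix.simps(2) seq_prefix_iff)
      qed
      then show ?thesis using p(1) InfW by auto
    qed
  qed
qed

section \<open>Represented spaces and problems\<close>

definition represented_space :: "'x set \<Rightarrow> (baire \<rightharpoonup> 'x) \<Rightarrow> bool" where
  "represented_space X \<delta> \<longleftrightarrow> ran \<delta> = X"

text \<open>
  \<open>p\<close> names a point of the domain of \<open>f\<close>, i.e. \<open>p \<in> dom (f \<delta>\<^sub>X)\<close>.
\<close>

definition name_dom :: "(baire \<rightharpoonup> 'x) \<Rightarrow> ('x \<times> 'y) set \<Rightarrow> baire set" where
  "name_dom \<delta>\<^sub>X f = {p. \<exists>x. \<delta>\<^sub>X p = Some x \<and> x \<in> Domain f}"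

text \<open>
  \<open>\<delta>\<^sub>Y F(p) \<in> f \<delta>\<^sub>X(p)\<close>, which includes that \<open>\<delta>\<^sub>Y F(p)\<close> is defined.
\<close>

definition solves_at ::
  "(baire \<rightharpoonup> 'x) \<Rightarrow> (baire \<rightharpoonup> 'y) \<Rightarrow> ('x \<times> 'y) set \<Rightarrow> (baire \<rightharpoonup> baire) \<Rightarrow> baire \<Rightarrow> bool" where
  "solves_at \<delta>\<^sub>X \<delta>\<^sub>Y f F p \<longleftrightarrow>
     (\<exists>x y. \<delta>\<^sub>X p = Some x \<and> (\<delta>\<^sub>Y \<circ>\<^sub>m F) p = Some y \<and> (x, y) \<in> f)"

definition is_realizer ::
  "(baire \<rightharpoonup> 'x) \<Rightarrow> (baire \<rightharpoonup> 'y) \<Rightarrow> ('x \<times> 'y) set \<Rightarrow> (baire \<rightharpoonup> baire) \<Rightarrow> bool" where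
  "is_realizer \<delta>\<^sub>X \<delta>\<^sub>Y f F \<longleftrightarrow> (\<forall>p \<in> name_dom \<delta>\<^sub>X f. solves_at \<delta>\<^sub>X \<delta>\<^sub>Y f F p)"

definition is_problem ::
  "'x set \<Rightarrow> (baire \<rightharpoonup> 'x) \<Rightarrow> 'y set \<Rightarrow> (baire \<rightharpoonup> 'y) \<Rightarrow> ('x \<times> 'y) set \<Rightarrow> bool" where
  "is_problem X \<delta>\<^sub>X Y \<delta>\<^sub>Y f \<longleftrightarrow>
     represented_space X \<delta>\<^sub>X \<and> represented_space Y \<delta>\<^sub>Y \<and> f \<subseteq> X \<times> Y \<and>
     (\<exists>F. is_realizer \<delta>\<^sub>X \<delta>\<^sub>Y f F)"

definition continuous_partial :: "(baire \<rightharpoonup> baire) \<Rightarrow> bool" where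
  "continuous_partial F \<longleftrightarrow> continuous_on (dom F) (\<lambda>p. the (F p))"

definition continuous_problem ::
  "(baire \<rightharpoonup> 'x) \<Rightarrow> (baire \<rightharpoonup> 'y) \<Rightarrow> ('x \<times> 'y) set \<Rightarrow> bool" where
  "continuous_problem \<delta>\<^sub>X \<delta>\<^sub>Y f \<longleftrightarrow> (\<exists>F. is_realizer \<delta>\<^sub>X \<delta>\<^sub>Y f F \<and> continuous_partial F)"

text \<open>
  The realizer version \<open>\<delta>\<^sub>Y\<^sup>-\<^sup>1 \<circ> f \<circ> \<delta>\<^sub>X\<close>. Composition of multivalued functions restricts the domain to
  inputs all of whose intermediate values can be continued; as \<open>\<delta>\<^sub>X\<close> is single-valued and \<open>\<delta>\<^sub>Y\<close> is
  surjective, this is ordinary relational composition here.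
\<close>

definition realizer_version ::
  "(baire \<rightharpoonup> 'x) \<Rightarrow> (baire \<rightharpoonup> 'y) \<Rightarrow> ('x \<times> 'y) set \<Rightarrow> (baire \<times> baire) set" where
  "realizer_version \<delta>\<^sub>X \<delta>\<^sub>Y f = Map.graph \<delta>\<^sub>X O f O (Map.graph \<delta>\<^sub>Y)\<inverse>"

lemma Domain_realizer_version:
  assumes "is_problem X \<delta>\<^sub>X Y \<delta>\<^sub>Y f"
  shows "Domain (realizer_version \<delta>\<^sub>X \<delta>\<^sub>Y f) = name_dom \<delta>\<^sub>X f"
proof
  show "Domain (realizer_version \<delta>\<^sub>X \<delta>\<^sub>Y f) \<subseteq> name_dom \<delta>\<^sub>X f"
    by (auto simp: realizer_version_def name_dom_def Map.graph_def)
  show "name_dom \<delta>\<^sub>X f \<subseteq> Domain (realizer_version \<delta>\<^sub>X \<delta>\<^sub>Y f)"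
  proof
    fix p assume "p \<in> name_dom \<delta>\<^sub>X f"
    then obtain x y where xy: "\<delta>\<^sub>X p = Some x" "(x, y) \<in> f" by (auto simp: name_dom_def)
    then have "y \<in> ran \<delta>\<^sub>Y" using assms by (auto simp: is_problem_def represented_space_def)
    then obtain r where "\<delta>\<^sub>Y r = Some y" by (auto simp: ran_def)
    with xy show "p \<in> Domain (realizer_version \<delta>\<^sub>X \<delta>\<^sub>Y f)"
      by (auto simp: realizer_version_def Map.graph_def intro!: relcompI)
  qed
qed

section \<open>The representation of continuous partial functions\<close>

text \<open>
  Every \<open>q\<close> lists a sequence of pairs of words. To obtain a total representation, a pair is
  skipped if together with the pairs retained before it violates monotonicity; so the retained
  pairs always form the graph of a (possibly partial) monotone word function \<open>h\<close>, and if the listed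
  pairs already form such a graph then nothing is skipped.
\<close>

definition listed_pair :: "baire \<Rightarrow> nat \<Rightarrow> word \<times> word" where
  "listed_pair q n = map_prod list_decode list_decode (prod_decode (q n))"

definition monotone_graph :: "(word \<times> word) set \<Rightarrow> bool" where
  "monotone_graph G \<longleftrightarrow> (\<forall>(u, a) \<in> G. \<forall>(v, b) \<in> G. prefix u v \<longrightarrow> prefix a b)"

function retained :: "baire \<Rightarrow> nat \<Rightarrow> bool" where
  "retained q n \<longleftrightarrow>
     (\<forall>m\<in>{..<n}. retained q m \<longrightarrow> monotone_graph {listed_pair q m, listed_pair q n})"
  by pat_completeness auto
termination by (relation "Wellfounded.measure snd") auto

declare retained.simps [simp del]

definition word_graph :: "baire \<Rightarrow> (word \<times> word) set" where
  "word_graph q = {listed_pair q n | n. retained q n}"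

definition Phi :: "baire \<Rightarrow> baire \<rightharpoonup> baire" where
  "Phi q p = (case word_sup {a. \<exists>w. seq_prefix w p \<and> (w, a) \<in> word_graph q} of
                InfW r \<Rightarrow> Some r | FinW _ \<Rightarrow> None)"

lemma monotone_graph_subset: "monotone_graph G \<Longrightarrow> H \<subseteq> G \<Longrightarrow> monotone_graph H"
  unfolding monotone_graph_def by blast

lemma monotone_graph_single_valued: "monotone_graph G \<Longrightarrow> single_valued G"
  unfolding monotone_graph_def single_valued_def
  by (fastforce intro: prefix_order.antisym)

lemma monotone_graph_word_graph: "monotone_graph (word_graph q)"
proof -
  have sym: "monotone_graph {a, b} = monotone_graph {b, a}" for a b
    by (simp add: insert_commute)
  have less: "monotone_graph {listed_pair q m, listed_pair q n}"
    if "m < n" "retained q m" "retained q n" for m n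
    using that retained.simps[of q n] by auto
  have pair: "monotone_graph {listed_pair q m, listed_pair q n}"
    if "retained q m" "retained q n" for m n
    using less[of m n] less[of n m] that sym
    by (cases m n rule: linorder_cases) (auto simp: monotone_graph_def split: prod.splits)
  show ?thesis
    unfolding monotone_graph_def
  proof clarify
    fix u a v b
    assume "(u, a) \<in> word_graph q" "(v, b) \<in> word_graph q" and uv: "prefix u v"
    then obtain m n where "retained q m" "retained q n"
      and mn: "listed_pair q m = (u, a)" "listed_pair q n = (v, b)"
      by (force simp: word_graph_def)
    then show "prefix a b" using pair[of m n] uv by (simp add: mn monotone_graph_def)
  qed
qed

lemma word_graph_listed:
  assumes "monotone_graph (range (listed_pair q))"
  shows "word_graph q = range (listed_pair q)"
proof -
  have "monotone_graph {listed_pair q m, listed_pair q n}" for m n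
    by (rule monotone_graph_subset[OF assms]) auto
  then have "retained q n" for n
    by (simp add: retained.simps[of q n])
  then show ?thesis by (auto simp: word_graph_def)
qed

lemma word_chain_word_graph: "word_chain {a. \<exists>w. seq_prefix w p \<and> (w, a) \<in> word_graph q}"
  unfolding word_chain_def
proof clarify
  fix a b u v
  assume "seq_prefix u p" "(u, a) \<in> word_graph q" "seq_prefix v p" "(v, b) \<in> word_graph q"
    and "\<not> prefix b a"
  then show "prefix a b"
    using monotone_graph_word_graph[of q] seq_prefix_comparable[of u p v]
    unfolding monotone_graph_def by blast
qed

lemma Phi_total_word_function:
  assumes "\<And>u v. prefix u v \<Longrightarrow> prefix (h u) (h v)"
    and "range (listed_pair q) = {(w, h w) | w. True}"
  shows "Phi q p = (case word_sup (h ` {w. seq_prefix w p}) of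
                      InfW r \<Rightarrow> Some r | FinW _ \<Rightarrow> None)"
proof -
  have "monotone_graph (range (listed_pair q))"
    unfolding assms(2) using assms(1) by (auto simp: monotone_graph_def)
  then have "word_graph q = {(w, h w) | w. True}"
    using word_graph_listed assms(2) by simp
  then have "{a. \<exists>w. seq_prefix w p \<and> (w, a) \<in> word_graph q} = h ` {w. seq_prefix w p}"
    by auto
  then show ?thesis by (simp add: Phi_def)
qed

lemma Phi_eq_SomeI:
  assumes "\<And>w a. seq_prefix w p \<Longrightarrow> (w, a) \<in> word_graph q \<Longrightarrow> seq_prefix a r"
    and "\<And>k. \<exists>w a. seq_prefix w p \<and> (w, a) \<in> word_graph q \<and> k < length a"
  shows "Phi q p = Some r"
proof -
  let ?W = "{a. \<exists>w. seq_prefix w p \<and> (w, a) \<in> word_graph q}"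
  have "infinite ?W"
  proof
    assume "finite ?W"
    then have fin: "finite (length ` ?W)" by simp
    obtain a where a: "a \<in> ?W" "Max (length ` ?W) < length a" using assms(2) by blast
    from a(1) have "length a \<le> Max (length ` ?W)" by (rule Max_ge[OF fin imageI])
    with a(2) show False by simp
  qed
  then obtain s where s: "word_sup ?W = InfW s"
    by (rule word_sup_infinite[OF word_chain_word_graph])
  have "inf_word_prefix (word_sup ?W) (InfW r)"
    using assms(1) by (intro word_sup_is_lub(2)[OF word_chain_word_graph]) auto
  then show ?thesis using s by (simp add: Phi_def)
qed

lemma continuous_partial_local:
  assumes "continuous_partial F" "F p = Some r"
  shows "\<exists>n. \<forall>p' r'. F p' = Some r' \<longrightarrow> seq_prefix (seq_take n p) p' \<longrightarrow> seq_prefix (seq_take k r) r'"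
proof -
  let ?U = "Pi\<^sub>E UNIV (\<lambda>i. if i < k then {r i} else UNIV) :: baire set"
  have fin: "finite {i. (if i < k then {r i} else UNIV) \<noteq> UNIV}"
    by (rule finite_subset[of _ "{..<k}"]) auto
  have "open ?U"
    by (rule open_PiE[OF _ fin]) (simp add: open_discrete)
  moreover have "the (F p) \<in> ?U" using assms(2) by (simp add: PiE_iff)
  ultimately have "\<exists>V. open V \<and> p \<in> V \<and> (\<forall>p'\<in>dom F. p' \<in> V \<longrightarrow> the (F p') \<in> ?U)"
    using assms(1) domI[of F, OF assms(2)]
    unfolding continuous_partial_def continuous_on_topological by blast
  then obtain V where V: "open V" "p \<in> V"
    "\<And>p'. p' \<in> dom F \<Longrightarrow> p' \<in> V \<Longrightarrow> the (F p') \<in> ?U"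
    by blast
  from V(1,2) have "openin (product_topology (\<lambda>i. euclidean) UNIV) V"
    by (simp add: open_fun_def)
  then obtain B where B: "p \<in> Pi\<^sub>E UNIV B" "finite {i. B i \<noteq> UNIV}" "Pi\<^sub>E UNIV B \<subseteq> V"
    using product_topology_open_contains_basis[of "\<lambda>i. euclidean" UNIV V p] V(2) by auto
  obtain n where n: "\<And>i. B i \<noteq> UNIV \<Longrightarrow> i < n"
    using B(2) unfolding finite_nat_set_iff_bounded by blast
  show ?thesis
  proof (intro exI[of _ n] allI impI)
    fix p' r' assume p': "F p' = Some r'" "seq_prefix (seq_take n p) p'"
    have "p' i \<in> B i" for i
    proof (cases "B i = UNIV")
      case False
      then have "p' i = p i" using n[of i] p'(2) by (simp add: seq_prefix_iff)
      then show ?thesis using B(1) by (simp add: PiE_iff)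
    qed simp
    then have "p' \<in> V" using B(3) by auto
    then have "r' \<in> ?U" using V(3)[of p'] p'(1) by auto
    then show "seq_prefix (seq_take k r) r'"
      by (fastforce simp: seq_prefix_iff PiE_iff split: if_splits)
  qed
qed

lemma Phi_extends_continuous:
  assumes "continuous_partial F"
  shows "\<exists>q. F \<subseteq>\<^sub>m Phi q"
proof (cases "dom F = {}")
  case True
  then show ?thesis by (simp add: map_le_def)
next
  case False
  define common where "common w n \<longleftrightarrow>
    (\<forall>p r p' r'. F p = Some r \<longrightarrow> F p' = Some r' \<longrightarrow> seq_prefix w p \<longrightarrow> seq_prefix w p' \<longrightarrow>
       seq_take n r = seq_take n r')" for w n
  define len where "len w = (GREATEST n. n \<le> length w \<and> common w n)" for w
  define G where "G = {(w, seq_take (len w) r) | w p r. F p = Some r \<and> seq_prefix w p}"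
  have len: "len w \<le> length w \<and> common w (len w)" for w
    unfolding len_def
    by (rule GreatestI_nat[where k = 0 and b = "length w"]) (auto simp: common_def seq_take_def)
  have len_max: "n \<le> len w" if "n \<le> length w" "common w n" for w n
    unfolding len_def by (rule Greatest_le_nat[where b = "length w"]) (use that in auto)
  have seq_prefix_mono: "seq_prefix u p" if "prefix u v" "seq_prefix v p" for u v p
    using that by (auto simp: seq_prefix_iff prefix_iff_nth)
  have "monotone_graph G"
    unfolding monotone_graph_def G_def
  proof (clarsimp)
    fix u v p r p' r'
    assume a: "F p = Some r" "seq_prefix u p" "F p' = Some r'" "seq_prefix v p'" "prefix u v"
    have "common v (len u)"
      using len[of u] a(5) seq_prefix_mono unfolding common_def by blast
    then have le: "len u \<le> len v"
      using len[of u] prefix_length_le[OF a(5)] by (intro len_max) auto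
    have "seq_take (len u) r = seq_take (len u) r'"
      using len[of u] a seq_prefix_mono unfolding common_def by blast
    then show "prefix (seq_take (len u) r) (seq_take (len v) r')"
      using le by (simp add: prefix_iff_nth)
  qed
  moreover obtain q where q: "range (listed_pair q) = G"
  proof -
    obtain p r where "F p = Some r" using False by (meson domD ex_in_conv)
    then have ne: "G \<noteq> {}"
      unfolding G_def using seq_prefix_seq_take by blast
    define q where "q n = prod_encode (map_prod list_encode list_encode (from_nat_into G n))" for n
    have "listed_pair q n = from_nat_into G n" for n
      by (simp add: listed_pair_def q_def prod.map_comp o_def prod.map_ident_strong
          map_prod_def split: prod.splits)
    then have "range (listed_pair q) = range (from_nat_into G)" by auto
    also have "\<dots> = G"
      by (rule range_from_nat_into[OF ne]) (rule countableI_type)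
    finally show thesis using that by blast
  qed
  ultimately have G: "word_graph q = G"
    using word_graph_listed by metis
  have "Phi q p = Some r" if pr: "F p = Some r" for p r
  proof (rule Phi_eq_SomeI)
    fix w a assume w: "seq_prefix w p" "(w, a) \<in> word_graph q"
    then obtain p' r' where "a = seq_take (len w) r'" "F p' = Some r'" "seq_prefix w p'"
      unfolding G G_def by blast
    moreover from this have "seq_take (len w) r' = seq_take (len w) r"
      using pr w(1) len[of w] unfolding common_def by blast
    ultimately show "seq_prefix a r" by simp
  next
    fix k
    obtain n where n: "\<And>p' r'. F p' = Some r' \<Longrightarrow> seq_prefix (seq_take n p) p' \<Longrightarrow>
        seq_prefix (seq_take (Suc k) r) r'"
      using continuous_partial_local[OF assms pr, of "Suc k"] by blast
    define w where "w = seq_take (max n (Suc k)) p"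
    have "common w (Suc k)"
      unfolding common_def
    proof (intro allI impI)
      fix p1 r1 p2 r2
      assume b: "F p1 = Some r1" "F p2 = Some r2" "seq_prefix w p1" "seq_prefix w p2"
      have "prefix (seq_take n p) w"
        by (simp add: w_def prefix_iff_nth)
      then have "seq_prefix (seq_take (Suc k) r) r1" "seq_prefix (seq_take (Suc k) r) r2"
        using n b seq_prefix_mono by blast+
      then show "seq_take (Suc k) r1 = seq_take (Suc k) r2"
        by (simp add: seq_prefix_def)
    qed
    then have "k < len w" using len_max[of "Suc k" w] by (simp add: w_def)
    moreover have wp: "seq_prefix w p" by (simp add: w_def)
    moreover have "(w, seq_take (len w) r) \<in> word_graph q"
      unfolding G G_def using pr wp by blast
    ultimately show "\<exists>w a. seq_prefix w p \<and> (w, a) \<in> word_graph q \<and> k < length a"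
      by (intro exI[of _ w] exI[of _ "seq_take (len w) r"]) simp
  qed
  then show ?thesis by (intro exI[of _ q]) (auto simp: map_le_def)
qed

definition effectively_discontinuous ::
  "(baire \<rightharpoonup> 'x) \<Rightarrow> (baire \<rightharpoonup> 'y) \<Rightarrow> ('x \<times> 'y) set \<Rightarrow> bool" where
  "effectively_discontinuous \<delta>\<^sub>X \<delta>\<^sub>Y f \<longleftrightarrow>
     (\<exists>D :: baire \<Rightarrow> baire. continuous_on UNIV D \<and>
        (\<forall>q. D q \<in> name_dom \<delta>\<^sub>X f \<and> \<not> solves_at \<delta>\<^sub>X \<delta>\<^sub>Y f (Phi q) (D q)))"

section \<open>Wadge games\<close>

definition infinite_concat :: "(nat \<Rightarrow> word) \<Rightarrow> inf_word" where
  "infinite_concat xs = word_sup (range (\<lambda>n. concat (map xs [0..<n])))"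

lemma word_chain_concat: "word_chain (range (\<lambda>n. concat (map xs [0..<n])))"
proof -
  have mono: "prefix (concat (map xs [0..<m])) (concat (map xs [0..<n]))" if "m \<le> n" for m n
    using that by (induction n rule: dec_induct) (auto intro: prefix_order.trans)
  show ?thesis unfolding word_chain_def
  proof clarify
    fix m n
    assume "\<not> prefix (concat (map xs [0..<n])) (concat (map xs [0..<m]))"
    then show "prefix (concat (map xs [0..<m])) (concat (map xs [0..<n]))"
      using mono[of m n] mono[of n m] by linarith
  qed
qed

definition II_wins_run ::
  "(baire \<times> baire) set \<Rightarrow> (nat \<Rightarrow> word) \<Rightarrow> (nat \<Rightarrow> word) \<Rightarrow> bool" where
  "II_wins_run g xs ys \<longleftrightarrow>
     (infinite_concat xs, infinite_concat ys) \<in> map_prod InfW InfW ` g \<or>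
     infinite_concat xs \<notin> InfW ` Domain g"

definition winning_strategy_II :: "(baire \<times> baire) set \<Rightarrow> (word list \<Rightarrow> word) \<Rightarrow> bool" where
  "winning_strategy_II g \<sigma> \<longleftrightarrow>
     (\<forall>xs ys. (\<forall>i. ys i = \<sigma> (map xs [0..<Suc i])) \<longrightarrow> II_wins_run g xs ys)"

definition winning_strategy_I :: "(baire \<times> baire) set \<Rightarrow> (word list \<Rightarrow> word) \<Rightarrow> bool" where
  "winning_strategy_I g \<sigma> \<longleftrightarrow>
     (\<forall>xs ys. (\<forall>i. xs i = \<sigma> (map ys [0..<i])) \<longrightarrow> \<not> II_wins_run g xs ys)"

end

theory Submission
  imports Defs
begin

text \<open>
  The name \<open>q\<close> of a continuous function \<open>\<Phi>\<^sub>q\<close> can be run on a growing history of words: the first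
  \<open>n\<close> words and the first \<open>n\<close> entries of \<open>q\<close> determine a finite output, these outputs increase with
  \<open>n\<close>, and their increments are the moves of a player. For (1) this turns a continuous realizer into
  a strategy of Player II; conversely a strategy answering the moves \<open>p(0), p(1), \<dots>\<close> computes a
  continuous realizer. For (2), a winning strategy of Player I played against the strategy
  induced by \<open>q\<close> produces \<open>D(q)\<close>. Conversely, given \<open>D\<close>, Player I turns the moves \<open>y\<^sub>0, y\<^sub>1, \<dots>\<close> of
  Player II into a name \<open>q\<close> of the monotone word function \<open>w \<mapsto> y\<^sub>0 \<dots> y\<^bsub>|w|-1\<^esub>\<close>, so that
  \<open>\<Phi>\<^sub>q\<close> is constantly \<open>y\<close> whenever \<open>y\<close> is infinite, and plays \<open>D(q)\<close>.
\<close>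

section \<open>Infinite suprema of words\<close>

text \<open>A finite supremum would bound the lengths in the chain, so an infinite one amounts to a
  common bound \<open>r\<close> and unbounded lengths. Infinite runs and values of
  \<open>Phi\<close> are both reduced to this criterion.\<close>

lemma word_sup_eq_InfW_iff:
  assumes "word_chain W"
  shows "word_sup W = InfW r \<longleftrightarrow> (\<forall>w\<in>W. seq_prefix w r) \<and> (\<forall>k. \<exists>w\<in>W. k < length w)"
proof
  assume sup: "word_sup W = InfW r"
  then have "infinite W" by (auto simp: word_sup_def split: if_splits)
  then show "(\<forall>w\<in>W. seq_prefix w r) \<and> (\<forall>k. \<exists>w\<in>W. k < length w)"
    using word_sup_is_lub(1)[OF assms] word_chain_infinite_long[OF assms] sup by auto
next
  assume W: "(\<forall>w\<in>W. seq_prefix w r) \<and> (\<forall>k. \<exists>w\<in>W. k < length w)"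
  have "inf_word_prefix (word_sup W) (InfW r)"
    using W by (intro word_sup_is_lub(2)[OF assms]) simp
  moreover have "word_sup W \<noteq> FinW m" for m
  proof
    assume m: "word_sup W = FinW m"
    obtain w where "w \<in> W" "length m < length w" using W by blast
    moreover from this have "prefix w m" using word_sup_is_lub(1)[OF assms] m by auto
    ultimately show False by (simp add: prefix_iff_nth)
  qed
  ultimately show "word_sup W = InfW r" by (cases "word_sup W") auto
qed

lemma infinite_concat_eq_InfW_iff:
  "infinite_concat xs = InfW r \<longleftrightarrow>
     (\<forall>n. seq_prefix (concat (map xs [0..<n])) r) \<and>
     (\<forall>k. \<exists>n. k < length (concat (map xs [0..<n])))"
  unfolding infinite_concat_def word_sup_eq_InfW_iff[OF word_chain_concat] by simp

lemma Phi_eq_Some_iff: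
  "Phi q p = Some r \<longleftrightarrow>
     (\<forall>w a. seq_prefix w p \<longrightarrow> (w, a) \<in> word_graph q \<longrightarrow> seq_prefix a r) \<and>
     (\<forall>k. \<exists>w a. seq_prefix w p \<and> (w, a) \<in> word_graph q \<and> k < length a)"
proof -
  have "Phi q p = Some r \<longleftrightarrow>
      word_sup {a. \<exists>w. seq_prefix w p \<and> (w, a) \<in> word_graph q} = InfW r"
    by (auto simp: Phi_def split: inf_word.splits)
  then show ?thesis
    unfolding word_sup_eq_InfW_iff[OF word_chain_word_graph] by blast
qed

lemma prefix_concat_upt:
  assumes "m \<le> n"
  shows "prefix (concat (map ys [0..<m])) (concat (map ys [0..<n]))"
  using assms by (induction n rule: dec_induct) (auto intro: prefix_order.trans)

lemma seq_prefix_mono: "prefix u v \<Longrightarrow> seq_prefix v p \<Longrightarrow> seq_prefix u p"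
  by (auto simp: seq_prefix_iff prefix_iff_nth)

lemma infinite_concat_singletons: "infinite_concat (\<lambda>i. [p i]) = InfW p"
proof -
  have "concat (map (\<lambda>i. [p i]) [0..<n]) = seq_take n p" for n
    by (induction n) (auto simp: seq_take_def)
  then show ?thesis by (auto simp: infinite_concat_eq_InfW_iff)
qed

section \<open>Continuity from finite dependence\<close>

lemma open_agreeing: "open {p' :: baire. \<forall>i<n. p' i = p i}"
proof -
  let ?B = "\<lambda>i. if i < n then {p i} else UNIV"
  have "open (Pi\<^sub>E UNIV ?B)"
    by (rule open_PiE[OF _ finite_subset[of _ "{..<n}"]]) (auto simp: open_discrete)
  also have "Pi\<^sub>E UNIV ?B = {p'. \<forall>i<n. p' i = p i}"
    by (auto simp: PiE_iff split: if_splits)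
  finally show ?thesis .
qed

lemma continuous_on_baireI:
  fixes F :: "baire \<Rightarrow> baire"
  assumes "\<And>p k. p \<in> S \<Longrightarrow> \<exists>n. \<forall>p'\<in>S. (\<forall>i<n. p' i = p i) \<longrightarrow> F p' k = F p k"
  shows "continuous_on S F"
proof (rule continuous_on_coordinatewise_then_product)
  fix k
  show "continuous_on S (\<lambda>p. F p k)"
    unfolding continuous_on_topological
  proof (intro ballI allI impI)
    fix p B assume p: "p \<in> S" "F p k \<in> B"
    obtain n where "\<forall>p'\<in>S. (\<forall>i<n. p' i = p i) \<longrightarrow> F p' k = F p k"
      using assms p(1) by blast
    then show "\<exists>A. open A \<and> p \<in> A \<and> (\<forall>y\<in>S. y \<in> A \<longrightarrow> F y k \<in> B)"
      using p(2) by (intro exI[of _ "{p'. \<forall>i<n. p' i = p i}"]) (auto simp: open_agreeing)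
  qed
qed

text \<open>Entry \<open>k\<close> of \<open>F p\<close> already appears in finitely many of the
  words \<open>K p i\<close>, and these depend on finitely many entries of \<open>p\<close>. Applied
  to the replies of Player II in (1) and to the moves of Player I in (2).\<close>

lemma continuous_on_infinite_concat:
  fixes K :: "baire \<Rightarrow> nat \<Rightarrow> word" and F :: "baire \<Rightarrow> baire"
  assumes K: "\<And>p p' i. (\<And>j. j \<le> i \<Longrightarrow> p' j = p j) \<Longrightarrow> K p' i = K p i"
    and F: "\<And>p. p \<in> S \<Longrightarrow> infinite_concat (K p) = InfW (F p)"
  shows "continuous_on S F"
proof (rule continuous_on_baireI)
  fix p k assume "p \<in> S"
  then obtain n where n: "k < length (concat (map (K p) [0..<n]))"
    using F[of p] unfolding infinite_concat_eq_InfW_iff by blast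
  have "F p' k = F p k" if p': "p' \<in> S" "\<forall>i<n. p' i = p i" for p'
  proof -
    have "map (K p') [0..<n] = map (K p) [0..<n]"
      using p'(2) by (auto intro!: K)
    then show ?thesis
      using n F[OF p'(1)] F[OF \<open>p \<in> S\<close>]
      unfolding infinite_concat_eq_InfW_iff seq_prefix_iff by metis
  qed
  then show "\<exists>n. \<forall>p'\<in>S. (\<forall>i<n. p' i = p i) \<longrightarrow> F p' k = F p k" by blast
qed

section \<open>Strategies from monotone functions of the history\<close>

text \<open>Reading \<open>H l\<close> as the total output after history \<open>l\<close>, this is
  the part added in the last round. As \<open>butlast [] = []\<close>, it is empty on the empty
  history.\<close>

definition increment :: "(word list \<Rightarrow> word) \<Rightarrow> word list \<Rightarrow> word" where
  "increment H l = drop (length (H (butlast l))) (H l)"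

text \<open>Telescoping: by monotonicity, \<open>drop\<close> removes exactly what was played
  before.\<close>

lemma concat_increment:
  assumes "H [] = []"
    and "\<And>n. prefix (H (map xs [0..<n])) (H (map xs [0..<Suc n]))"
  shows "concat (map (\<lambda>i. increment H (map xs [0..<Suc i])) [0..<n]) = H (map xs [0..<n])"
proof (induction n)
  case 0
  then show ?case using assms(1) by simp
next
  case (Suc n)
  have "increment H (map xs [0..<Suc n]) =
      drop (length (H (map xs [0..<n]))) (H (map xs [0..<Suc n]))"
    by (simp add: increment_def)
  with Suc assms(2)[of n] show ?case by (auto simp: prefix_def)
qed

section \<open>Running a name on a history\<close>

text \<open>The length of the history acts as a clock: only the first \<open>length l\<close> pairs
  of \<open>q\<close> are inspected. So each stage uses a finite part of \<open>q\<close>, and even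
  empty moves advance the search.\<close>

definition stage_words :: "baire \<Rightarrow> word list \<Rightarrow> word set" where
  "stage_words q l =
     {snd (listed_pair q n) | n. n < length l \<and> retained q n \<and>
        prefix (fst (listed_pair q n)) (concat l)}"

text \<open>The set is finite, so the default \<open>[]\<close> in the \<open>InfW\<close> case
  never arises.\<close>

definition stage_output :: "baire \<Rightarrow> word list \<Rightarrow> word" where
  "stage_output q l = (case word_sup (stage_words q l) of FinW m \<Rightarrow> m | InfW _ \<Rightarrow> [])"

lemma finite_stage_words: "finite (stage_words q l)"
proof -
  have "stage_words q l \<subseteq> (\<lambda>n. snd (listed_pair q n)) ` {..<length l}"
    by (auto simp: stage_words_def)
  then show ?thesis by (rule finite_subset) simp
qed

lemma stage_words_iff:
  "a \<in> stage_words q l \<longleftrightarrow>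
     (\<exists>n u. n < length l \<and> retained q n \<and> listed_pair q n = (u, a) \<and> prefix u (concat l))"
  unfolding stage_words_def by (auto simp: prod_eq_iff)

lemma word_chain_stage_words: "word_chain (stage_words q l)"
  unfolding word_chain_def
proof (intro ballI)
  fix a b assume "a \<in> stage_words q l" "b \<in> stage_words q l"
  then obtain u v where "(u, a) \<in> word_graph q" "(v, b) \<in> word_graph q"
    "prefix u (concat l)" "prefix v (concat l)"
    unfolding stage_words_iff word_graph_def by force
  then show "prefix a b \<or> prefix b a"
    using monotone_graph_word_graph[of q] prefix_same_cases[of u "concat l" v]
    unfolding monotone_graph_def by blast
qed

lemma stage_output:
  shows "stage_output q l \<in> insert [] (stage_words q l)"
    and "a \<in> stage_words q l \<Longrightarrow> prefix a (stage_output q l)"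
  using word_sup_finite[OF word_chain_stage_words finite_stage_words, of q l]
  by (metis inf_word.simps(5) stage_output_def)+

lemma stage_output_Nil: "stage_output q [] = []"
  using stage_output(1)[of q "[]"] by (simp add: stage_words_def)

lemma stage_output_mono:
  assumes "prefix l l'"
  shows "prefix (stage_output q l) (stage_output q l')"
proof -
  have "prefix (concat l) (concat l')" using assms by (auto simp: prefix_def)
  then have "stage_words q l \<subseteq> stage_words q l'"
    using prefix_length_le[OF assms] prefix_order.trans unfolding stage_words_def by fastforce
  then show ?thesis
    using stage_output(1)[of q l] stage_output(2)[of _ q l'] by auto
qed

lemma retained_cong:
  assumes "\<And>i. i \<le> n \<Longrightarrow> q' i = q i"
  shows "retained q' n = retained q n"
  using assms
proof (induction n rule: less_induct)
  case (less n)
  then have "listed_pair q' m = listed_pair q m" if "m \<le> n" for m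
    using that by (simp add: listed_pair_def)
  then show ?case
    using less by (simp add: retained.simps[of _ n])
qed

text \<open>This finite use of \<open>q\<close> is what makes the function \<open>D\<close> obtained
  from a strategy of Player I continuous.\<close>

lemma stage_output_cong:
  assumes "\<And>i. i < length l \<Longrightarrow> q' i = q i"
  shows "stage_output q' l = stage_output q l"
proof -
  have "retained q' n = retained q n" "listed_pair q' n = listed_pair q n" if "n < length l" for n
    using that assms by (auto intro!: retained_cong simp: listed_pair_def)
  then have "stage_words q' l = stage_words q l"
    unfolding stage_words_def by force
  then show ?thesis by (simp add: stage_output_def)
qed

lemma stage_output_limit:
  assumes "infinite_concat xs = InfW p" "Phi q p = Some r"
  shows "seq_prefix (stage_output q (map xs [0..<n])) r"
    and "\<exists>n. k < length (stage_output q (map xs [0..<n]))"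
proof -
  have xs: "\<And>n. seq_prefix (concat (map xs [0..<n])) p"
    "\<And>k. \<exists>n. k < length (concat (map xs [0..<n]))"
    using assms(1) unfolding infinite_concat_eq_InfW_iff by blast+
  have Phi: "\<And>w a. seq_prefix w p \<Longrightarrow> (w, a) \<in> word_graph q \<Longrightarrow> seq_prefix a r"
    "\<And>k. \<exists>w a. seq_prefix w p \<and> (w, a) \<in> word_graph q \<and> k < length a"
    using assms(2) unfolding Phi_eq_Some_iff by blast+
  have "seq_prefix a r" if "a \<in> stage_words q (map xs [0..<n])" for a
  proof -
    obtain u where "(u, a) \<in> word_graph q" "prefix u (concat (map xs [0..<n]))"
      using \<open>a \<in> _\<close> unfolding stage_words_iff word_graph_def by force
    then show ?thesis using Phi(1) xs(1) seq_prefix_mono by blast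
  qed
  then show "seq_prefix (stage_output q (map xs [0..<n])) r"
    using stage_output(1)[of q "map xs [0..<n]"] by (auto simp: seq_prefix_iff)
  obtain w a m where w: "seq_prefix w p" "k < length a" "retained q m" "listed_pair q m = (w, a)"
    using Phi(2)[of k] unfolding word_graph_def by force
  obtain n0 where n0: "length w < length (concat (map xs [0..<n0]))" using xs(2) by blast
  \<comment> \<open>By this stage the pair with index \<open>m\<close> has been inspected and the
    history has grown past \<open>w\<close>.\<close>
  define n where "n = max n0 (Suc m)"
  then have "length w \<le> length (concat (map xs [0..<n]))"
    using n0 prefix_length_le[OF prefix_concat_upt[of n0 n xs]] by simp
  then have "prefix w (concat (map xs [0..<n]))"
    using w(1) xs(1)[of n] by (simp add: prefix_iff_nth seq_prefix_iff)
  moreover have "m < n" by (simp add: n_def)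
  ultimately have "a \<in> stage_words q (map xs [0..<n])"
    using w(3,4) unfolding stage_words_iff by auto
  then show "\<exists>n. k < length (stage_output q (map xs [0..<n]))"
    using w(2) stage_output(2) prefix_length_le order_less_le_trans by blast
qed

lemma infinite_concat_increment_stage_output:
  assumes "infinite_concat xs = InfW p" "Phi q p = Some r"
  shows "infinite_concat (\<lambda>i. increment (stage_output q) (map xs [0..<Suc i])) = InfW r"
proof -
  have "concat (map (\<lambda>i. increment (stage_output q) (map xs [0..<Suc i])) [0..<n]) =
      stage_output q (map xs [0..<n])" for n
    by (rule concat_increment) (simp_all add: stage_output_Nil stage_output_mono)
  then show ?thesis
    using stage_output_limit[OF assms] by (simp add: infinite_concat_eq_InfW_iff)
qed

section \<open>Player II and continuous realizers\<close>

text \<open>Player II plays the increments of some \<open>Phi q\<close> extending \<open>F\<close>;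
  the run is decided only at inputs in \<open>Domain g\<close>, where \<open>Phi q\<close> agrees
  with \<open>F\<close>.\<close>

lemma winning_strategy_II_if_continuous:
  assumes "continuous_partial F" "\<And>p. p \<in> Domain g \<Longrightarrow> \<exists>r. F p = Some r \<and> (p, r) \<in> g"
  shows "\<exists>\<sigma>. winning_strategy_II g \<sigma>"
proof -
  obtain q where q: "F \<subseteq>\<^sub>m Phi q" using Phi_extends_continuous[OF assms(1)] by blast
  have "winning_strategy_II g (increment (stage_output q))"
    unfolding winning_strategy_II_def II_wins_run_def
  proof (intro allI impI)
    fix xs ys assume "\<forall>i. ys i = increment (stage_output q) (map xs [0..<Suc i])"
    then have ys: "ys = (\<lambda>i. increment (stage_output q) (map xs [0..<Suc i]))" by blast
    show "(infinite_concat xs, infinite_concat ys) \<in> map_prod InfW InfW ` g \<or>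
        infinite_concat xs \<notin> InfW ` Domain g"
    proof (cases "infinite_concat xs \<in> InfW ` Domain g")
      case True
      then obtain p where p: "infinite_concat xs = InfW p" "p \<in> Domain g" by blast
      obtain r where r: "F p = Some r" "(p, r) \<in> g" using assms(2)[OF p(2)] by blast
      then have "Phi q p = Some r" using q by (metis domI map_le_def)
      then have "infinite_concat ys = InfW r"
        unfolding ys by (rule infinite_concat_increment_stage_output[OF p(1)])
      with p(1) r(2) show ?thesis by force
    qed simp
  qed
  then show ?thesis by blast
qed

lemma continuous_if_winning_strategy_II:
  assumes "winning_strategy_II g \<sigma>"
  shows "\<exists>F. continuous_partial F \<and> (\<forall>p\<in>Domain g. \<exists>r. F p = Some r \<and> (p, r) \<in> g)"
proof -
  define K where "K p i = \<sigma> (map (\<lambda>j. [p j]) [0..<Suc i])" for p :: baire and i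
  \<comment> \<open>\<open>F\<close> is undefined where the replies form a finite word; on
    \<open>Domain g\<close> the winning strategy forces an infinite one.\<close>
  define F where "F p = (case infinite_concat (K p) of InfW r \<Rightarrow> Some r | FinW _ \<Rightarrow> None)" for p
  have F: "F p = Some r \<longleftrightarrow> infinite_concat (K p) = InfW r" for p r
    by (simp add: F_def split: inf_word.splits)
  have "continuous_partial F"
    unfolding continuous_partial_def
  proof (rule continuous_on_infinite_concat[where K = K])
    fix p p' :: baire and i assume "\<And>j. j \<le> i \<Longrightarrow> p' j = p j"
    then have "map (\<lambda>j. [p' j]) [0..<Suc i] = map (\<lambda>j. [p j]) [0..<Suc i]" by auto
    then show "K p' i = K p i" by (simp only: K_def)
  next
    fix p assume "p \<in> dom F"
    then obtain r where "F p = Some r" by blast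
    then show "infinite_concat (K p) = InfW (the (F p))" using F[of p r] by simp
  qed
  moreover have "\<exists>r. F p = Some r \<and> (p, r) \<in> g" if "p \<in> Domain g" for p
  proof -
    have "II_wins_run g (\<lambda>i. [p i]) (K p)"
      using assms[unfolded winning_strategy_II_def, rule_format, of "K p" "\<lambda>i. [p i]"]
      by (simp only: K_def)
    then show ?thesis
      using that unfolding II_wins_run_def infinite_concat_singletons F by auto
  qed
  ultimately show ?thesis by blast
qed

section \<open>Player I and effective discontinuity\<close>

text \<open>The moves of Player I when \<open>\<sigma>\<close> meets a strategy
  \<open>\<tau>\<close> of Player II. The replies of II are inlined, and the recursive calls satisfy
  \<open>k \<le> j < i\<close>.\<close>

fun play_I :: "(word list \<Rightarrow> word) \<Rightarrow> (word list \<Rightarrow> word) \<Rightarrow> nat \<Rightarrow> word" where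
  "play_I \<sigma> \<tau> i = \<sigma> (map (\<lambda>j. \<tau> (map (\<lambda>k. play_I \<sigma> \<tau> k) [0..<Suc j])) [0..<i])"

declare play_I.simps [simp del]

text \<open>Before move \<open>i\<close>, Player II has been consulted only on histories of length
  at most \<open>i\<close>.\<close>

lemma play_I_cong:
  assumes "\<And>l. length l \<le> i \<Longrightarrow> \<tau>' l = \<tau> l"
  shows "play_I \<sigma> \<tau>' i = play_I \<sigma> \<tau> i"
  using assms
proof (induction i rule: less_induct)
  case (less i)
  have "\<tau>' (map (play_I \<sigma> \<tau>') [0..<Suc j]) = \<tau> (map (play_I \<sigma> \<tau>) [0..<Suc j])" if "j < i" for j
  proof -
    have "map (play_I \<sigma> \<tau>') [0..<Suc j] = map (play_I \<sigma> \<tau>) [0..<Suc j]"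
      using that less by (intro map_cong) auto
    moreover have "\<tau>' l = \<tau> l" if "length l = Suc j" for l
      using less.prems that \<open>j < i\<close> by simp
    ultimately show ?thesis by (metis length_map length_upt diff_zero)
  qed
  then show ?case
    unfolding play_I.simps[of _ _ i] by (intro arg_cong[where f = \<sigma>] map_cong) auto
qed

lemma diagonal_if_winning_strategy_I:
  assumes "winning_strategy_I g \<sigma>"
  shows "\<exists>D. continuous_on UNIV D \<and>
    (\<forall>q. D q \<in> Domain g \<and> \<not> (\<exists>r. Phi q (D q) = Some r \<and> (D q, r) \<in> g))"
proof -
  define xs where "xs q = play_I \<sigma> (increment (stage_output q))" for q
  define ys where "ys q i = increment (stage_output q) (map (xs q) [0..<Suc i])" for q i
  have "xs q i = \<sigma> (map (ys q) [0..<i])" for q i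
    unfolding ys_def xs_def by (rule play_I.simps)
  then have I_wins: "\<not> II_wins_run g (xs q) (ys q)" for q
    using assms unfolding winning_strategy_I_def by blast
  \<comment> \<open>Player I can win only by producing an infinite word in \<open>Domain g\<close>,
    so \<open>D q\<close> exists whatever the domain of \<open>Phi q\<close> is.\<close>
  then have "\<exists>p. infinite_concat (xs q) = InfW p \<and> p \<in> Domain g" for q
    unfolding II_wins_run_def by blast
  then obtain D where D: "\<And>q. infinite_concat (xs q) = InfW (D q)" "\<And>q. D q \<in> Domain g"
    by metis
  have "continuous_on UNIV D"
  proof (rule continuous_on_infinite_concat[where K = xs])
    fix q q' :: baire and i assume q': "\<And>j. j \<le> i \<Longrightarrow> q' j = q j"
    show "xs q' i = xs q i"
      unfolding xs_def
    proof (rule play_I_cong)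
      fix l :: "word list" assume "length l \<le> i"
      then show "increment (stage_output q') l = increment (stage_output q) l"
        using q' stage_output_cong[of l q' q] stage_output_cong[of "butlast l" q' q]
        by (simp add: increment_def)
    qed
  qed (rule D(1))
  \<comment> \<open>If \<open>Phi q\<close> solved \<open>g\<close> at \<open>D q\<close>, the
    strategy induced by \<open>q\<close> would play this solution and beat
    \<open>\<sigma>\<close>.\<close>
  moreover have "(D q, r) \<notin> g" if "Phi q (D q) = Some r" for q r
  proof
    assume "(D q, r) \<in> g"
    moreover have "infinite_concat (ys q) = InfW r"
      unfolding ys_def using D(1) that by (rule infinite_concat_increment_stage_output)
    ultimately show False using I_wins[of q] D(1)[of q] unfolding II_wins_run_def by force
  qed
  ultimately show ?thesis using D(2) by blast
qed

text \<open>Entry \<open>n\<close> lists the value at the word with code \<open>n\<close>. Letting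
  the value depend only on the length of the word makes the listed graph monotone.\<close>

definition constant_name :: "(nat \<Rightarrow> word) \<Rightarrow> baire" where
  "constant_name ys n =
     prod_encode (n, list_encode (concat (map ys [0..<length (list_decode n)])))"

lemma length_list_decode_le: "length (list_decode n) \<le> n"
proof -
  have "length l \<le> list_encode l" for l
  proof (induction l)
    case (Cons a l)
    then show ?case using le_prod_encode_2[of "list_encode l" a] by simp
  qed simp
  from this[of "list_decode n"] show ?thesis by simp
qed

text \<open>A word with code \<open>n\<close> has at most \<open>n\<close> letters, so Player I can
  compute entry \<open>n\<close> from the moves of Player II before move \<open>n\<close>.\<close>

lemma constant_name_cong:
  assumes "\<And>i. i < n \<Longrightarrow> ys' i = ys i"
  shows "constant_name ys' n = constant_name ys n"
proof -
  have "map ys' [0..<length (list_decode n)] = map ys [0..<length (list_decode n)]"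
    using assms length_list_decode_le[of n] by auto
  then show ?thesis by (simp only: constant_name_def)
qed

lemma Phi_constant_name:
  assumes "infinite_concat ys = InfW r"
  shows "Phi (constant_name ys) p = Some r"
proof -
  let ?h = "\<lambda>w :: word. concat (map ys [0..<length w])"
  have pair: "listed_pair (constant_name ys) n = (list_decode n, ?h (list_decode n))" for n
    by (simp add: listed_pair_def constant_name_def)
  have "monotone_graph (range (listed_pair (constant_name ys)))"
    unfolding monotone_graph_def
    by (auto simp: pair dest: prefix_length_le intro: prefix_concat_upt)
  then have "word_graph (constant_name ys) = range (listed_pair (constant_name ys))"
    by (rule word_graph_listed)
  also have "\<dots> = range (\<lambda>w. (w, ?h w))"
    unfolding pair by (auto simp: image_iff) (metis list_encode_inverse)
  finally have graph: "(w, a) \<in> word_graph (constant_name ys) \<longleftrightarrow> a = ?h w" for w a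
    by auto
  have ys: "\<And>n. seq_prefix (concat (map ys [0..<n])) r"
    "\<And>k. \<exists>n. k < length (concat (map ys [0..<n]))"
    using assms unfolding infinite_concat_eq_InfW_iff by blast+
  show ?thesis
  proof (rule Phi_eq_SomeI)
    fix k
    obtain n where "k < length (concat (map ys [0..<n]))" using ys(2) by blast
    then show "\<exists>w a. seq_prefix w p \<and> (w, a) \<in> word_graph (constant_name ys) \<and> k < length a"
      unfolding graph
      by (intro exI[of _ "seq_take n p"] exI[of _ "concat (map ys [0..<n])"]) simp
  qed (simp add: graph ys(1))
qed

text \<open>As \<open>D\<close> is total, it equals some \<open>Phi d\<close>. Player I runs
  \<open>d\<close> on the name \<open>q\<close> of the constant function built from the moves of II,
  and so produces \<open>D q\<close>.\<close>

lemma winning_strategy_I_if_diagonal: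
  fixes D :: "baire \<Rightarrow> baire"
  assumes "continuous_on UNIV D"
    and D: "\<And>q. D q \<in> Domain g" "\<And>q r. Phi q (D q) = Some r \<Longrightarrow> (D q, r) \<notin> g"
  shows "\<exists>\<sigma>. winning_strategy_I g \<sigma>"
proof -
  have "continuous_partial (\<lambda>q. Some (D q))"
    using assms(1) by (simp add: continuous_partial_def dom_def)
  then obtain d where "(\<lambda>q. Some (D q)) \<subseteq>\<^sub>m Phi d" using Phi_extends_continuous by blast
  then have d: "Phi d q = Some (D q)" for q by (simp add: map_le_def dom_def)
  \<comment> \<open>Entry \<open>n\<close> reads \<open>l ! i\<close> only for \<open>i < n\<close>,
    hence never beyond the end of \<open>l\<close>.\<close>
  define hist where "hist l = map (\<lambda>n. [constant_name (\<lambda>i. l ! i) n]) [0..<length l]" for l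
  define H where "H l = stage_output d (hist l)" for l
  have hist: "hist (map ys [0..<n]) = map (\<lambda>i. [constant_name ys i]) [0..<n]" for ys n
    unfolding hist_def by (auto intro!: constant_name_cong)
  have "winning_strategy_I g (increment H)"
    unfolding winning_strategy_I_def
  proof (intro allI impI)
    fix xs ys assume xs: "\<forall>i. xs i = increment H (map ys [0..<i])"
    define q where "q = constant_name ys"
    have H0: "H [] = []" using hist[of ys 0] by (simp add: H_def stage_output_Nil)
    have "concat (map (\<lambda>i. xs (Suc i)) [0..<n]) = H (map ys [0..<n])" for n
      unfolding xs[rule_format]
      by (rule concat_increment[of H, OF H0]) (simp only: H_def hist, simp add: stage_output_mono)
    \<comment> \<open>Player I opens with the empty word, which accounts for the shift by
      one.\<close>
    moreover have "concat (map xs [0..<Suc n]) = concat (map (\<lambda>i. xs (Suc i)) [0..<n])" for n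
      using xs H0 by (simp add: map_upt_Suc increment_def del: upt_Suc)
    ultimately have concat_xs:
      "concat (map xs [0..<Suc n]) = stage_output d (map (\<lambda>i. [q i]) [0..<n])" for n
      by (simp only: H_def hist q_def)
    note lim = stage_output_limit[OF infinite_concat_singletons[of q] d[of q]]
    have "infinite_concat xs = InfW (D q)"
      unfolding infinite_concat_eq_InfW_iff
    proof (intro conjI allI)
      fix n
      have "seq_prefix (concat (map xs [0..<Suc n])) (D q)"
        unfolding concat_xs by (rule lim(1))
      then show "seq_prefix (concat (map xs [0..<n])) (D q)"
        by (rule seq_prefix_mono[OF prefix_concat_upt, rotated]) simp
    next
      fix k
      show "\<exists>n. k < length (concat (map xs [0..<n]))"
        using lim(2)[of k] unfolding concat_xs[symmetric] by blast
    qed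
    moreover have "(D q, r) \<notin> g" if "infinite_concat ys = InfW r" for r
      using D(2) Phi_constant_name[OF that] unfolding q_def by blast
    \<comment> \<open>If the moves of II form only a finite word, Player I wins because
      \<open>D q\<close> lies in \<open>Domain g\<close>.\<close>
    ultimately show "\<not> II_wins_run g xs ys"
      using D(1)[of q] by (auto simp: II_wins_run_def)
  qed
  then show ?thesis by blast
qed

section \<open>The Wadge game of a problem\<close>

text \<open>Turns both claims into statements about the single relation
  \<open>realizer_version \<delta>\<^sub>X \<delta>\<^sub>Y f\<close>, to which the results for
  general \<open>g\<close> apply.\<close>

lemma solves_at_iff:
  "solves_at \<delta>\<^sub>X \<delta>\<^sub>Y f F p \<longleftrightarrow> (\<exists>r. F p = Some r \<and> (p, r) \<in> realizer_version \<delta>\<^sub>X \<delta>\<^sub>Y f)"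
  by (auto simp: solves_at_def realizer_version_def Map.graph_def map_comp_def relcomp_unfold
      split: option.splits)

theorem theorem27:
  fixes X :: "'x set" and \<delta>\<^sub>X :: "(nat \<Rightarrow> nat) \<rightharpoonup> 'x"
    and Y :: "'y set" and \<delta>\<^sub>Y :: "(nat \<Rightarrow> nat) \<rightharpoonup> 'y"
    and f :: "('x \<times> 'y) set"
  assumes "is_problem X \<delta>\<^sub>X Y \<delta>\<^sub>Y f"
  shows "(continuous_problem \<delta>\<^sub>X \<delta>\<^sub>Y f \<longleftrightarrow>
            (\<exists>\<sigma>. winning_strategy_II (realizer_version \<delta>\<^sub>X \<delta>\<^sub>Y f) \<sigma>)) \<and>
         (effectively_discontinuous \<delta>\<^sub>X \<delta>\<^sub>Y f \<longleftrightarrow>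
            (\<exists>\<sigma>. winning_strategy_I (realizer_version \<delta>\<^sub>X \<delta>\<^sub>Y f) \<sigma>))"
proof (intro conjI iffI)
  let ?g = "realizer_version \<delta>\<^sub>X \<delta>\<^sub>Y f"
  note unfolds = continuous_problem_def is_realizer_def effectively_discontinuous_def
    solves_at_iff Domain_realizer_version[OF assms, symmetric]
  show "\<exists>\<sigma>. winning_strategy_II ?g \<sigma>" if "continuous_problem \<delta>\<^sub>X \<delta>\<^sub>Y f"
    using that winning_strategy_II_if_continuous[of _ ?g] unfolding unfolds by blast
  show "continuous_problem \<delta>\<^sub>X \<delta>\<^sub>Y f" if "\<exists>\<sigma>. winning_strategy_II ?g \<sigma>"
    using that continuous_if_winning_strategy_II[of ?g] unfolding unfolds by blast
  show "\<exists>\<sigma>. winning_strategy_I ?g \<sigma>" if "effectively_discontinuous \<delta>\<^sub>X \<delta>\<^sub>Y f"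
    using that winning_strategy_I_if_diagonal[of _ ?g] unfolding unfolds by blast
  show "effectively_discontinuous \<delta>\<^sub>X \<delta>\<^sub>Y f" if "\<exists>\<sigma>. winning_strategy_I ?g \<sigma>"
    using that diagonal_if_winning_strategy_I[of ?g] unfolding unfolds by blast
qed

end
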